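(* Let $q\in(0,1)$ and let $f(z)=\sum_{n=0}^\infty A_nz^n$ with $A_0=0$, $A_1=1$. For $n\ge 0$ put $$B_n=\frac{A_{n+1}(1-q^{n+1})}{1-q}-\frac{A_n(1-q^n)}{1-q},$$ and suppose that $$\sum_{n=1}^\infty|B_n-B_{n-1}|\le 1 .$$ Then $f\in\mathcal{K}_q$ with the function $g(z)=z/(1-z)^2$.
   Context: $\mathbb{D}=\{z\in\mathbb{C}:|z|<1\}$. $\mathcal{A}$ is the class of functions $f$ analytic in $\mathbb{D}$ with $f(0)=0=f'(0)-1$. $\mathcal{S}^*\subset\mathcal{A}$ is the class of univalent functions $g\in\mathcal{A}$ that are starlike with respect to the origin ($tw\in g(\mathbb{D})$ whenever $t\in[0,1]$, $w\in g(\mathbb{D})$). For $q\in(0,1)$ and $f\in\mathcal{A}$, the $q$-difference operator is $(D_qf)(z)=\dfrac{f(z)-f(qz)}{z(1-q)}$ for $z\in\mathbb{D}\setminus\{0\}$, and $(D_qf)(0)=f'(0)$. A function $f\in\mathcal{A}$ belongs to $\mathcal{K}_q$ ($q$-close-to-convex functions) if there exists $g\in\mathcal{S}^*$ such that $$\left|\frac{z}{g(z)}(D_qf)(z)-\frac{1}{1-q}\right|\le\frac{1}{1-q},\quad z\in\mathbb{D}$$ (where $z/g(z)$ is given its limit value $1$ at $z=0$); one then says that $f\in\mathcal{K}_q$ with the function $g$. The coefficients $A_n$ are complex numbers. *)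

theory Defs
  imports "HOL-Complex_Analysis.Complex_Analysis"
begin

text \<open>Functions on the unit disc are total functions of which only the values on
  \<open>ball 0 1\<close> matter.\<close>

definition normalized_analytic :: "(complex \<Rightarrow> complex) set" where
  "normalized_analytic = {f. f analytic_on ball 0 1 \<and> f 0 = 0 \<and> deriv f 0 = 1}"

text \<open>The library's \<open>starlike\<close> leaves the centre existentially quantified; here the
  image has to be starlike with respect to the origin.\<close>

definition starlike_univalent :: "(complex \<Rightarrow> complex) set" where
  "starlike_univalent = {g \<in> normalized_analytic. inj_on g (ball 0 1) \<and>
     (\<forall>t\<in>{0..1::real}. \<forall>w\<in>g ` ball 0 1. of_real t * w \<in> g ` ball 0 1)}"

definition q_difference :: "real \<Rightarrow> (complex \<Rightarrow> complex) \<Rightarrow> complex \<Rightarrow> complex" where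
  "q_difference q f z =
     (if z = 0 then deriv f 0 else (f z - f (of_real q * z)) / (z * (1 - of_real q)))"

text \<open>The quotient \<open>z / g z\<close>, with its limit value \<open>1\<close> at the origin; that this is the
  limit uses \<open>g 0 = 0\<close> and \<open>deriv g 0 = 1\<close>.\<close>

definition id_over :: "(complex \<Rightarrow> complex) \<Rightarrow> complex \<Rightarrow> complex" where
  "id_over g z = (if z = 0 then 1 else z / g z)"

definition q_close_to_convex_with ::
    "real \<Rightarrow> (complex \<Rightarrow> complex) \<Rightarrow> (complex \<Rightarrow> complex) \<Rightarrow> bool" where
  "q_close_to_convex_with q f g \<longleftrightarrow>
     f \<in> normalized_analytic \<and> g \<in> starlike_univalent \<and>
     (\<forall>z\<in>ball 0 1.
        cmod (id_over g z * q_difference q f z - 1 / (1 - of_real q)) \<le> 1 / (1 - q))"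

definition q_close_to_convex :: "real \<Rightarrow> (complex \<Rightarrow> complex) set" where
  "q_close_to_convex q = {f. \<exists>g. q_close_to_convex_with q f g}"

end

theory Submission imports Defs begin

text \<open>Write \<open>c n = A n * (1 - q ^ n) / (1 - q)\<close>. The \<open>q\<close>-difference operator multiplies the
  \<open>n\<close>-th coefficient by \<open>(1 - q ^ n) / (1 - q)\<close> and lowers the degree by one, so \<open>z\<close> times the
  \<open>q\<close>-difference of \<open>f\<close> is the power series with coefficients \<open>c n\<close>. For the Koebe function
  \<open>g z = z / (1 - z)\<^sup>2\<close> the factor \<open>z / g z\<close> is \<open>(1 - z)\<^sup>2\<close>, and multiplying a power series by
  \<open>1 - z\<close> takes differences of its coefficients (\<open>sums_powser_difference\<close>). Two such
  multiplications turn \<open>c\<close> into \<open>B\<close> and \<open>B\<close> into its differences: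
  the expression to be estimated is \<open>W z = 1 + (\<Sum>n. (B (n + 1) - B n) * z ^ (n + 1))\<close>, whence
  \<open>\<bar>W z - 1\<bar> \<le> 1\<close>. The disc of radius \<open>1\<close> about \<open>1\<close> lies in the disc of radius \<open>1 / (1 - q)\<close>
  about \<open>1 / (1 - q)\<close> (they touch at \<open>0\<close>), and this is the required bound.

  Two facts remain. The bounded variation of \<open>B\<close> makes \<open>B\<close> bounded by \<open>2\<close>, hence
  \<open>c\<close> and \<open>A\<close> of at most linear growth; this gives the convergence in the unit disc that the
  argument needs. And the Koebe function is starlike and univalent (\<open>koebe_starlike_univalent\<close>),
  which the Cayley transform reduces to the map \<open>w \<mapsto> w\<^sup>2\<close> on the right half-plane.\<close>

section \<open>The Koebe function\<close>

text \<open>A point \<open>w\<close> of the right half-plane is closer to \<open>1\<close> than to \<open>-1\<close>.\<close>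

lemma norm_cayley_less_1:
  fixes w :: complex
  assumes "Re w > 0"
  shows "cmod ((w - 1) / (w + 1)) < 1"
proof -
  have "cmod (w - 1) < cmod (w + 1)"
    using assms by (simp add: cmod_def power2_eq_square algebra_simps)
  moreover from this have "cmod (w + 1) > 0"
    by (metis norm_ge_zero order_le_less_trans)
  ultimately show ?thesis
    by (simp add: norm_divide)
qed

lemma Re_inverse_cayley_pos:
  fixes z :: complex
  assumes "cmod z < 1"
  shows "Re ((1 + z) / (1 - z)) > 0"
proof -
  have "z \<noteq> 1" using assms by auto
  then have pos: "(cmod (1 - z))\<^sup>2 > 0" by simp
  have "(cmod z)\<^sup>2 < 1"
    using assms by (simp add: power_less_one_iff)
  then have "(Re z)\<^sup>2 + (Im z)\<^sup>2 < 1" by (simp add: cmod_power2)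
  moreover have "Re ((1 + z) * cnj (1 - z)) = 1 - ((Re z)\<^sup>2 + (Im z)\<^sup>2)"
    by (simp add: power2_eq_square algebra_simps)
  moreover have "Re ((1 + z) / (1 - z)) = Re ((1 + z) * cnj (1 - z)) / (cmod (1 - z))\<^sup>2"
    by (simp only: complex_div_cnj[of "1 + z" "1 - z"] of_real_power[symmetric] Re_divide_of_real)
  ultimately show ?thesis
    using pos by (simp only: divide_pos_pos diff_gt_0_iff_gt)
qed

text \<open>In the half-plane coordinate \<open>w = (1 + z) / (1 - z)\<close> the Koebe function is an affine
  function of \<open>w\<^sup>2\<close>, so its image can be read off from the squares of the half-plane.\<close>

lemma koebe_inverse_cayley:
  fixes z :: complex
  assumes "z \<noteq> 1"
  shows "z / (1 - z)\<^sup>2 = (((1 + z) / (1 - z))\<^sup>2 - 1) / 4"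
proof -
  have "(1 + z)\<^sup>2 - (1 - z)\<^sup>2 = 4 * z"
    by (simp add: power2_eq_square algebra_simps)
  moreover have "((1 + z) / (1 - z))\<^sup>2 - 1 = ((1 + z)\<^sup>2 - (1 - z)\<^sup>2) / (1 - z)\<^sup>2"
    using assms by (simp add: power_divide diff_divide_distrib)
  ultimately show ?thesis by simp
qed

lemma koebe_cayley:
  fixes w :: complex
  assumes "w + 1 \<noteq> 0"
  shows "((w - 1) / (w + 1)) / (1 - (w - 1) / (w + 1))\<^sup>2 = (w\<^sup>2 - 1) / 4"
proof -
  have minus: "1 - (w - 1) / (w + 1) = 2 / (w + 1)"
    and plus: "1 + (w - 1) / (w + 1) = 2 * w / (w + 1)"
    using assms by (simp_all add: field_simps)
  have "(1 + (w - 1) / (w + 1)) / (1 - (w - 1) / (w + 1)) = w"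
    unfolding minus plus using assms by simp
  moreover have "(w - 1) / (w + 1) \<noteq> 1"
    using minus assms by auto
  ultimately show ?thesis
    using koebe_inverse_cayley[of "(w - 1) / (w + 1)"] by simp
qed

text \<open>The squares of the points of the right half-plane fill the plane slit along the
  nonpositive real axis, and that slit plane is starlike with respect to \<open>1\<close>. The principal
  square root supplies the point.\<close>

lemma half_plane_squares_starlike_1:
  fixes w :: complex and t :: real
  assumes "Re w > 0" and "0 \<le> t" and "t \<le> 1"
  obtains v where "Re v > 0" and "v\<^sup>2 - 1 = of_real t * (w\<^sup>2 - 1)"
proof -
  define v where "v = csqrt (of_real t * (w\<^sup>2 - 1) + 1)"
  have sq: "v\<^sup>2 = of_real t * (w\<^sup>2 - 1) + 1"
    by (simp add: v_def)
  have "Re v \<noteq> 0"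
  proof
    assume Re0: "Re v = 0"
    have re: "- (Im v)\<^sup>2 = t * ((Re w)\<^sup>2 - (Im w)\<^sup>2 - 1) + 1"
      using arg_cong[OF sq, of Re] Re0 by (simp add: power2_eq_square)
    have im: "t * (Re w * Im w) = 0"
      using arg_cong[OF sq, of Im] Re0 by (auto simp: power2_eq_square)
    show False
    proof (cases "t = 0")
      case True
      with re have "(Im v)\<^sup>2 = -1" by simp
      then show False by (metis zero_le_power2 not_one_le_zero neg_0_le_iff_le)
    next
      case False
      with im assms(1) have "Im w = 0" by simp
      with re have "- (Im v)\<^sup>2 = t * (Re w)\<^sup>2 + (1 - t)"
        by (simp add: algebra_simps)
      moreover have "t * (Re w)\<^sup>2 > 0" using False assms by simp
      ultimately show False
        using assms(3) zero_le_power2[of "Im v"] by linarith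
    qed
  qed
  moreover have "Re v \<ge> 0"
    unfolding v_def using csqrt_principal by (metis order_le_less)
  ultimately have "Re v > 0" by simp
  then show ?thesis using that sq by simp
qed

lemma koebe_image_starlike_0:
  fixes z :: complex and t :: real
  assumes "z \<in> ball 0 1" and "0 \<le> t" and "t \<le> 1"
  shows "of_real t * (z / (1 - z)\<^sup>2) \<in> (\<lambda>z. z / (1 - z)\<^sup>2) ` ball 0 1"
proof -
  define w where "w = (1 + z) / (1 - z)"
  have "z \<noteq> 1" and "cmod z < 1" using assms(1) by auto
  then have "Re w > 0"
    unfolding w_def by (intro Re_inverse_cayley_pos)
  from this assms(2,3) obtain v where v: "Re v > 0" "v\<^sup>2 - 1 = of_real t * (w\<^sup>2 - 1)"
    by (rule half_plane_squares_starlike_1)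
  have "v + 1 \<noteq> 0"
    using v(1) by (auto simp: complex_eq_iff)
  then have "((v - 1) / (v + 1)) / (1 - (v - 1) / (v + 1))\<^sup>2 = of_real t * (w\<^sup>2 - 1) / 4"
    using v(2) koebe_cayley by simp
  also have "\<dots> = of_real t * (z / (1 - z)\<^sup>2)"
    using koebe_inverse_cayley[OF \<open>z \<noteq> 1\<close>] by (simp only: w_def times_divide_eq_right)
  finally show ?thesis
    using norm_cayley_less_1[OF v(1)] by (intro image_eqI[of _ _ "(v - 1) / (v + 1)"]) auto
qed

text \<open>The equation \<open>z / (1 - z)\<^sup>2 = w / (1 - w)\<^sup>2\<close> amounts to \<open>(z - w) * (1 - z * w) = 0\<close>, and
  the second factor has no zeros in the disc.\<close>

lemma koebe_inj_on: "inj_on (\<lambda>z::complex. z / (1 - z)\<^sup>2) (ball 0 1)"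
proof (rule inj_onI)
  fix z w :: complex
  assume zw: "z \<in> ball 0 1" "w \<in> ball 0 1" and eq: "z / (1 - z)\<^sup>2 = w / (1 - w)\<^sup>2"
  have "z \<noteq> 1" "w \<noteq> 1" using zw by auto
  with eq have "z * (1 - w)\<^sup>2 = w * (1 - z)\<^sup>2"
    by (simp add: frac_eq_eq)
  then have "(z - w) * (1 - z * w) = 0"
    by (simp add: power2_eq_square algebra_simps)
  moreover have "cmod (z * w) < 1"
    using zw mult_strict_mono'[of "cmod z" 1 "cmod w" 1] by (simp add: norm_mult)
  then have "1 - z * w \<noteq> 0" by auto
  ultimately show "z = w" by simp
qed

lemma koebe_starlike_univalent: "(\<lambda>z. z / (1 - z)\<^sup>2) \<in> starlike_univalent"
proof -
  have "(\<lambda>z::complex. z / (1 - z)\<^sup>2) analytic_on ball 0 1"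
    by (intro analytic_intros) auto
  moreover have "((\<lambda>z::complex. z / (1 - z)\<^sup>2) has_field_derivative 1) (at 0)"
    by (auto intro!: derivative_eq_intros)
  then have "deriv (\<lambda>z::complex. z / (1 - z)\<^sup>2) 0 = 1"
    by (rule DERIV_imp_deriv)
  ultimately show ?thesis
    using koebe_inj_on koebe_image_starlike_0
    by (auto simp: starlike_univalent_def normalized_analytic_def)
qed

section \<open>Power series and differences of coefficients\<close>

lemma sums_powser_difference:
  fixes a :: "nat \<Rightarrow> 'a::real_normed_field"
  assumes "(\<lambda>n. a n * z ^ n) sums s"
  shows "(\<lambda>n. (a (Suc n) - a n) * z ^ Suc n) sums ((1 - z) * s - a 0)"
proof -
  have "(\<lambda>n. a (Suc n) * z ^ Suc n) sums (s - a 0)"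
    using assms by (subst sums_Suc_iff) simp
  from sums_diff[OF this sums_mult[OF assms, of z]] show ?thesis
    by (simp add: algebra_simps)
qed

lemma summable_powser_linear_growth:
  fixes a :: "nat \<Rightarrow> 'a::{real_normed_field,banach}"
  assumes "\<And>n. norm (a n) \<le> M * of_nat (Suc n)" and "norm z < 1"
  shows "summable (\<lambda>n. a n * z ^ n)"
proof (rule summable_comparison_test')
  show "summable (\<lambda>n. M * (of_nat (Suc n) * norm z ^ n))"
    using geometric_deriv_sums[of "norm z"] assms(2)
    by (intro summable_mult) (auto simp: sums_iff)
  show "norm (a n * z ^ n) \<le> M * (of_nat (Suc n) * norm z ^ n)" for n
    using mult_right_mono[OF assms(1)[of n], of "norm z ^ n"]
    by (simp add: norm_mult norm_power mult.assoc)
qed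

lemma norm_le_initial_plus_variation:
  fixes b :: "nat \<Rightarrow> 'a::real_normed_vector"
  assumes "summable (\<lambda>n. norm (b (n + 1) - b n))"
  shows "norm (b n) \<le> norm (b 0) + (\<Sum>n. norm (b (n + 1) - b n))"
proof -
  have "b n = b 0 + (\<Sum>k<n. b (k + 1) - b k)"
    by (simp add: sum_lessThan_telescope)
  also have "norm \<dots> \<le> norm (b 0) + (\<Sum>k<n. norm (b (k + 1) - b k))"
    by (intro norm_triangle_mono order_refl norm_sum)
  also have "(\<Sum>k<n. norm (b (k + 1) - b k)) \<le> (\<Sum>n. norm (b (n + 1) - b n))"
    using assms by (intro sum_le_suminf) auto
  finally show ?thesis by simp
qed

lemma norm_le_linear_growth:
  fixes c :: "nat \<Rightarrow> 'a::real_normed_vector"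
  assumes "\<And>n. norm (c (Suc n) - c n) \<le> M"
  shows "norm (c n) \<le> norm (c 0) + M * of_nat n"
proof (induction n)
  case (Suc n)
  have "norm (c (Suc n)) \<le> norm (c n) + norm (c (Suc n) - c n)"
    by (metis norm_triangle_ineq add.commute diff_add_cancel)
  with Suc assms[of n] show ?case by (simp add: algebra_simps)
qed simp

lemma powser_normalized_analytic:
  fixes a :: "nat \<Rightarrow> complex"
  assumes f: "\<And>z. z \<in> ball 0 1 \<Longrightarrow> f z = (\<Sum>n. a n * z ^ n)"
    and summ: "\<And>z. cmod z < 1 \<Longrightarrow> summable (\<lambda>n. a n * z ^ n)"
    and a: "a 0 = 0" "a 1 = 1"
  shows "f \<in> normalized_analytic"
proof -
  have deriv: "(f has_field_derivative (\<Sum>n. diffs a n * z ^ n)) (at z)" if "z \<in> ball 0 1" for z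
  proof (rule has_field_derivative_transform_within_open[OF _ open_ball that])
    show "((\<lambda>z. \<Sum>n. a n * z ^ n) has_field_derivative (\<Sum>n. diffs a n * z ^ n)) (at z)"
      using that by (intro termdiffs_strong'[OF summ]) auto
  qed (simp add: f)
  have "f analytic_on ball 0 1"
    using deriv unfolding analytic_on_open[OF open_ball] holomorphic_on_open[OF open_ball] by blast
  moreover have "f 0 = 0"
    using f[of 0] a(1) by simp
  moreover have "deriv f 0 = 1"
    using DERIV_imp_deriv[OF deriv[of 0]] a(2) by (simp add: diffs_def)
  ultimately show ?thesis
    by (simp add: normalized_analytic_def)
qed

section \<open>The coefficient criterion\<close>

lemma sums_q_difference:
  fixes A :: "nat \<Rightarrow> complex"
  assumes f: "\<And>z. z \<in> ball 0 1 \<Longrightarrow> f z = (\<Sum>n. A n * z ^ n)"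
    and summ: "\<And>z. cmod z < 1 \<Longrightarrow> summable (\<lambda>n. A n * z ^ n)"
    and q: "0 < q" "q < 1" and z: "cmod z < 1" "z \<noteq> 0"
  shows "(\<lambda>n. A n * (1 - of_real q ^ n) / (1 - of_real q) * z ^ n) sums (z * q_difference q f z)"
proof -
  have "cmod (of_real q * z) < 1"
    using q z(1) mult_strict_mono'[of q 1 "cmod z" 1] by (simp add: norm_mult)
  then have "(\<lambda>n. A n * (of_real q * z) ^ n) sums f (of_real q * z)"
    using f summ by (simp add: summable_sums)
  moreover have "(\<lambda>n. A n * z ^ n) sums f z"
    using f summ z by (simp add: summable_sums)
  ultimately have "(\<lambda>n. (A n * z ^ n - A n * (of_real q * z) ^ n) / (1 - of_real q))
      sums ((f z - f (of_real q * z)) / (1 - of_real q))"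
    by (intro sums_divide sums_diff)
  moreover have "(f z - f (of_real q * z)) / (1 - of_real q) = z * q_difference q f z"
    using z(2) by (simp add: q_difference_def)
  moreover have "(A n * z ^ n - A n * (of_real q * z) ^ n) / (1 - of_real q)
      = A n * (1 - of_real q ^ n) / (1 - of_real q) * z ^ n" for n
    by (simp add: power_mult_distrib algebra_simps)
  ultimately show ?thesis by simp
qed

text \<open>The factor \<open>(1 - q ^ n) / (1 - q)\<close> is at least \<open>1\<close> for \<open>n \<ge> 1\<close>, so passing to the
  coefficients of the \<open>q\<close>-difference does not shrink a coefficient.\<close>

lemma norm_le_norm_q_coefficient:
  fixes a :: complex
  assumes "0 < q" "q < 1" and "n \<noteq> 0"
  shows "cmod a \<le> cmod (a * (1 - of_real q ^ n) / (1 - of_real q))"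
proof -
  have "q ^ n \<le> q"
    using assms power_decreasing[of 1 n q] by simp
  then have "1 \<le> (1 - q ^ n) / (1 - q)"
    using assms by simp
  moreover have "(1 - of_real q ^ n) / (1 - of_real q) = complex_of_real ((1 - q ^ n) / (1 - q))"
    by simp
  then have "cmod ((1 - of_real q ^ n) / (1 - of_real q)) = \<bar>(1 - q ^ n) / (1 - q)\<bar>"
    by (simp only: norm_of_real)
  ultimately have "1 \<le> cmod ((1 - of_real q ^ n) / (1 - of_real q))"
    by linarith
  then show ?thesis
    using mult_left_mono[of 1 "cmod ((1 - of_real q ^ n) / (1 - of_real q))" "cmod a"]
    by (simp only: norm_mult[symmetric] times_divide_eq_right norm_ge_zero mult_1_right simp_thms)
qed

text \<open>The centres \<open>1\<close> and \<open>1 / (1 - q)\<close> are exactly as far apart as the radii \<open>1\<close> and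
  \<open>1 / (1 - q)\<close> differ, so one disc contains the other.\<close>

lemma norm_diff_inverse_le:
  fixes W :: complex
  assumes "0 < q" "q < 1" and "cmod (W - 1) \<le> 1"
  shows "cmod (W - 1 / (1 - of_real q)) \<le> 1 / (1 - q)"
proof -
  have "1 - 1 / (1 - complex_of_real q) = of_real (1 - 1 / (1 - q))"
    by simp
  then have "cmod (1 - 1 / (1 - complex_of_real q)) = \<bar>1 - 1 / (1 - q)\<bar>"
    by (simp only: norm_of_real)
  also have "\<dots> = 1 / (1 - q) - 1"
    using assms by (simp add: field_simps)
  finally show ?thesis
    using norm_triangle_ineq[of "W - 1" "1 - 1 / (1 - complex_of_real q)"] assms(3) by simp
qed

theorem theorem2p3:
  fixes q :: real and A B :: "nat \<Rightarrow> complex" and f :: "complex \<Rightarrow> complex"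
  assumes "0 < q" and "q < 1"
    and "\<And>z. z \<in> ball 0 1 \<Longrightarrow> f z = (\<Sum>n. A n * z ^ n)"
    and "A 0 = 0" and "A 1 = 1"
    and "\<And>n. B n = A (n + 1) * (1 - of_real q ^ (n + 1)) / (1 - of_real q)
                   - A n * (1 - of_real q ^ n) / (1 - of_real q)"
    and "summable (\<lambda>n. cmod (B (n + 1) - B n))"
    and "(\<Sum>n. cmod (B (n + 1) - B n)) \<le> 1"
  shows "q_close_to_convex_with q f (\<lambda>z. z / (1 - z)\<^sup>2)"
proof -
  define c where "c n = A n * (1 - of_real q ^ n) / (1 - of_real q)" for n
  have c0: "c 0 = 0" by (simp add: c_def)
  have Bc: "B n = c (Suc n) - c n" for n
    using assms(6) by (simp add: c_def)
  have B0: "B 0 = 1"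
    using assms(2,4,5,6) by simp
  have B_le: "cmod (B n) \<le> 2" for n
    using norm_le_initial_plus_variation[OF assms(7), of n] assms(8) B0 by simp
  have c_le: "cmod (c n) \<le> 2 * of_nat n" for n
    using norm_le_linear_growth[of c 2 n] B_le c0 by (simp add: Bc)
  have A_le: "cmod (A n) \<le> 2 * of_nat (Suc n)" for n
  proof (cases "n = 0")
    case False
    then have "cmod (A n) \<le> cmod (c n)"
      unfolding c_def using assms(1,2) by (intro norm_le_norm_q_coefficient)
    with c_le[of n] show ?thesis by simp
  qed (simp add: assms(4))
  have summ: "summable (\<lambda>n. A n * z ^ n)" if "cmod z < 1" for z
    using A_le that by (rule summable_powser_linear_growth)
  have f_analytic: "f \<in> normalized_analytic"
    using assms(3) summ assms(4,5) by (rule powser_normalized_analytic)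

  have "cmod (id_over (\<lambda>z. z / (1 - z)\<^sup>2) z * q_difference q f z - 1) \<le> 1"
    if "z \<in> ball 0 1" for z
  proof (cases "z = 0")
    case True
    then show ?thesis
      using f_analytic by (simp add: id_over_def q_difference_def normalized_analytic_def)
  next
    case False
    have z: "cmod z < 1" "z \<noteq> 1" using that by auto
    define D where "D = q_difference q f z"
    \<comment> \<open>Coefficients \<open>c\<close>, then \<open>B\<close>, then the differences of \<open>B\<close>. As \<open>c 0 = 0\<close>, the first
      multiplication by \<open>1 - z\<close> leaves a common factor \<open>z\<close>, which cancels.\<close>
    have "(\<lambda>n. c n * z ^ n) sums (z * D)"
      unfolding c_def D_def using assms(3) summ assms(1,2) z(1) False by (rule sums_q_difference)
    from sums_powser_difference[OF this]
    have "(\<lambda>n. z * (B n * z ^ n)) sums (z * ((1 - z) * D))"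
      by (simp add: Bc c0 algebra_simps)
    then have "(\<lambda>n. B n * z ^ n) sums ((1 - z) * D)"
      by (rule sums_mult_iff[OF False, THEN iffD1])
    from sums_powser_difference[OF this]
    have sums: "(\<lambda>n. (B (Suc n) - B n) * z ^ Suc n) sums ((1 - z)\<^sup>2 * D - 1)"
      by (simp add: B0 power2_eq_square mult.assoc)
    have le: "norm ((B (Suc n) - B n) * z ^ Suc n) \<le> cmod (B (n + 1) - B n)" for n
      using z(1) mult_left_mono[of "cmod z ^ Suc n" 1 "cmod (B (Suc n) - B n)"]
        power_le_one[of "cmod z" "Suc n"]
      by (simp add: norm_mult norm_power)
    have "cmod ((1 - z)\<^sup>2 * D - 1) \<le> (\<Sum>n. cmod (B (n + 1) - B n))"
      using sums_unique[OF sums] norm_suminf_le[OF le assms(7)] by simp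
    moreover have "id_over (\<lambda>z. z / (1 - z)\<^sup>2) z = (1 - z)\<^sup>2"
      using False z by (simp add: id_over_def)
    ultimately show ?thesis
      using assms(8) by (simp add: D_def)
  qed
  then show ?thesis
    unfolding q_close_to_convex_with_def
    using f_analytic koebe_starlike_univalent norm_diff_inverse_le[OF assms(1,2)] by blast
qed

end
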